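(* For all $k\in\mathbb{N}$, all $\varepsilon\in(0,1)$, all primes $p$, all $n,r\in\mathbb{N}$, and all functions $f:\mathbb{F}_p^n\to\mathbb{F}_p^r$ that are $\varepsilon$-far from being a group homomorphism, \[\Pr[\mathsf{RandomCoefficientsTest}_{2k}\text{ rejects } f]\ \ge\ \min\Big\{\frac{(2k-3)\varepsilon}{3},\ \frac1{16}\Big\}.\]
   Context: $\mathsf{RandomCoefficientsTest}_m$: draw $x_1,\dots,x_m\in\mathbb{F}_p^n$ independently and uniformly, and coefficients $\sigma_1,\dots,\sigma_m$ independently and uniformly from $\{1,\dots,p-1\}\subseteq\mathbb{F}_p$; let $a=\sum_{i\in[m]}\sigma_i x_i$ (scalar multiplication in $\mathbb{F}_p$); query $f(x_1),\dots,f(x_m),f(a)$; accept iff $\sum_{i\in[m]}\sigma_i f(x_i)=f(a)$, otherwise reject. $f$ is $\varepsilon$-far from being a homomorphism if $\Pr_x[f(x)\ne h(x)]>\varepsilon$ for every additive group homomorphism $h:\mathbb{F}_p^n\to\mathbb{F}_p^r$. *)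

theory Defs
  imports
    "HOL-Probability.Probability"
    "Jordan_Normal_Form.Matrix"
    "Berlekamp_Zassenhaus.Finite_Field"
begin

text \<open>
  The field of \<open>p\<close> elements is \<^typ>\<open>'p mod_ring\<close>, where \<open>p = CARD('p)\<close> is prime by the class
  \<^class>\<open>prime_card\<close>. Its \<open>n\<close>-fold power is \<^term>\<open>carrier_vec n\<close>, so that \<open>n\<close> is an ordinary
  natural number and \<open>n = 0\<close> is allowed. Functions between these powers are constrained, and matter,
  only on the carriers.
\<close>

text \<open>\<^const>\<open>pmf_of_set\<close> is specified only for finite nonempty sets; this and the next fact say
  that the three uniform distributions below are genuine.\<close>

lemma finite_carrier_vec_mod_ring:
  "finite (carrier_vec n :: 'p::prime_card mod_ring vec set)" "carrier_vec n \<noteq> ({} :: 'p mod_ring vec set)"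
proof -
  have "carrier_vec n \<subseteq> vec_of_list ` {xs :: 'p mod_ring list. set xs \<subseteq> UNIV \<and> length xs = n}"
  proof
    fix v :: "'p mod_ring vec" assume "v \<in> carrier_vec n"
    then have "v = vec_of_list (list_of_vec v)" "length (list_of_vec v) = n"
      by (auto simp: vec_list)
    then show "v \<in> vec_of_list ` {xs :: 'p mod_ring list. set xs \<subseteq> UNIV \<and> length xs = n}"
      by blast
  qed
  then show "finite (carrier_vec n :: 'p mod_ring vec set)"
    by (rule finite_subset) (intro finite_imageI finite_lists_length_eq finite)
  show "carrier_vec n \<noteq> ({} :: 'p mod_ring vec set)"
    using zero_carrier_vec by blast
qed

lemma finite_nonzero_mod_ring:
  "finite (- {0 :: 'p::prime_card mod_ring})" "- {0} \<noteq> ({} :: 'p mod_ring set)"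
  by (simp, metis ComplI empty_iff singletonD zero_neq_one)

definition far_from_hom ::
    "real \<Rightarrow> nat \<Rightarrow> nat \<Rightarrow> ('p::prime_card mod_ring vec \<Rightarrow> 'p mod_ring vec) \<Rightarrow> bool" where
  "far_from_hom \<epsilon> n r f \<longleftrightarrow>
     (\<forall>h \<in> hom (monoid_vec TYPE('p mod_ring) n) (monoid_vec TYPE('p mod_ring) r).
        measure_pmf.prob (pmf_of_set (carrier_vec n)) {x. f x \<noteq> h x} > \<epsilon>)"

text \<open>The distribution of the verdict of the test: \<^term>\<open>True\<close> is acceptance. The set
  \<^term>\<open>- {0}\<close> consists of the residues of \<open>1, \<dots>, p - 1\<close>, and \<^const>\<open>Pi_pmf\<close> draws independent
  components (its second argument is only the value outside the index set).\<close>

definition random_coefficients_test ::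
    "nat \<Rightarrow> nat \<Rightarrow> nat \<Rightarrow> ('p::prime_card mod_ring vec \<Rightarrow> 'p mod_ring vec) \<Rightarrow> bool pmf" where
  "random_coefficients_test m n r f =
     do {
       x \<leftarrow> Pi_pmf {1..m} (0\<^sub>v n) (\<lambda>_. pmf_of_set (carrier_vec n));
       \<sigma> \<leftarrow> Pi_pmf {1..m} 0 (\<lambda>_. pmf_of_set (- {0}));
       let a = finsum_vec TYPE('p mod_ring) n (\<lambda>i. \<sigma> i \<cdot>\<^sub>v x i) {1..m};
       return_pmf (finsum_vec TYPE('p mod_ring) r (\<lambda>i. \<sigma> i \<cdot>\<^sub>v f (x i)) {1..m} = f a)
     }"

end

theory Submission
  imports Defs
begin

text \<open>
  Let \<open>e\<close> be a nontrivial character of the prime field and let \<open>A(b, a)\<close> (\<open>fcoeff\<close>) be the average of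
  \<open>e (s (b \<bullet> f x + a \<bullet> x))\<close> over all \<open>x\<close> and all \<open>s \<noteq> 0\<close>. Thanks to the random coefficients
  this is a real number, and expanding the test into characters shows that it accepts with
  probability \<open>acc = (\<Sum>b a. A(b, a)^(m+1)) / |W|\<close>.

  Let \<open>N(s, w)\<close> (\<open>dens\<close>) be the probability that \<open>c f x + d f y = w\<close>, given \<open>c x + d y = s\<close>, for random
  \<open>x, y\<close> and \<open>c, d \<noteq> 0\<close>. Its Fourier transform is \<open>A\<^sup>2\<close>. If \<open>acc > 15/16\<close>, then Parseval gives
  \<open>(\<Sum>w. N(s, w)\<^sup>2) \<ge> 4 acc - 3 > 3/4\<close> for every \<open>s\<close>, so that \<open>N(s, h s) > 4/5\<close> for some \<open>h s\<close>.
  Since \<open>N\<close> is positive definite, \<open>N(s + t, h s + h t) > 1/5\<close>, which forces \<open>h\<close> to be additive.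

  Consequently every \<open>b\<close> has an \<open>\<alpha>\<^sub>b\<close> with \<open>\<alpha>\<^sub>b \<bullet> s = - (b \<bullet> h s)\<close> and \<open>A(b, \<alpha>\<^sub>b)\<^sup>2 \<ge> 3/5\<close>.
  If \<open>\<eta>\<close> denotes the distance of \<open>f\<close> and \<open>h\<close>, then \<open>t\<^sub>b = 1 - A(b, \<alpha>\<^sub>b)\<close> has mean \<open>\<eta>\<close> and is at
  most \<open>2 \<eta>\<close>. As \<open>A(b, \<alpha>\<^sub>b)\<close> dominates its slice and \<open>m\<close> is even, first \<open>1 - acc \<ge> \<eta>/4\<close>, so
  \<open>\<eta> < 1/4\<close> and \<open>A(b, \<alpha>\<^sub>b) > 0\<close>; then \<open>acc\<close> is at most the mean of \<open>(1 - t\<^sub>b)^(m-1)\<close>, and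
  Bernoulli's inequality yields the bound.
\<close>

unbundle no inner_syntax

subsection \<open>Additive characters of the prime field\<close>

definition add_char :: "'p::prime_card mod_ring \<Rightarrow> complex" where
  "add_char c = cis (2 * pi * of_int (to_int_mod_ring c) / CARD('p))"

lemma cis_cong_mod:
  assumes "p > 0"
  shows "cis (2 * pi * of_int (a mod int p) / p) = cis (2 * pi * of_int a / p)"
proof -
  have "of_int a = of_int (a mod int p) + of_int (a div int p) * (of_nat p :: real)"
    by (metis add.commute div_mult_mod_eq of_int_add of_int_mult of_int_of_nat_eq)
  then have "2 * pi * of_int a / p = 2 * pi * of_int (a mod int p) / p + 2 * pi * of_int (a div int p)"
    using assms by (simp add: field_simps)
  moreover have "cis (2 * pi * of_int (a div int p)) = 1"
    by (rule cis_multiple_2pi) auto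
  ultimately show ?thesis
    by (simp flip: cis_mult)
qed

lemma add_char_0 [simp]: "add_char 0 = 1"
  by (simp add: add_char_def)

lemma add_char_add: "add_char (a + b) = add_char a * add_char (b :: 'p::prime_card mod_ring)"
  using cis_cong_mod[of "CARD('p)" "to_int_mod_ring a + to_int_mod_ring b"]
  by (simp add: add_char_def to_int_mod_ring_add cis_mult add_divide_distrib ring_distribs)

lemma norm_add_char [simp]: "norm (add_char a) = 1"
  by (simp add: add_char_def)

lemma add_char_nonzero [simp]: "add_char a \<noteq> 0"
  using norm_add_char[of a] by (metis norm_zero zero_neq_one)

lemma add_char_minus: "add_char (- a) = cnj (add_char a)"
proof -
  have "add_char (- a) * add_char a = 1"
    by (metis add.left_inverse add_char_0 add_char_add)
  moreover have "cnj (add_char a) * add_char a = 1"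
    using complex_norm_square[of "add_char a"] by (simp add: mult.commute)
  ultimately show ?thesis
    by (metis add_char_nonzero mult_right_cancel)
qed

lemma add_char_diff: "add_char (a - b) = add_char a * cnj (add_char b)"
  using add_char_add[of a "- b"] by (simp add: add_char_minus)

lemma add_char_sum: "add_char (sum g A) = (\<Prod>i\<in>A. add_char (g i))"
  by (induction A rule: infinite_finite_induct) (auto simp: add_char_add)

text \<open>The representative lies in \<open>[0, p)\<close>, and \<open>cos\<close> equals 1 only
  when it is a multiple of \<open>p\<close>, hence 0.\<close>

lemma add_char_eq_1_iff: "add_char c = 1 \<longleftrightarrow> c = (0 :: 'p::prime_card mod_ring)"
proof
  assume "add_char c = 1"
  let ?t = "to_int_mod_ring c"
  have t: "0 \<le> ?t" "?t < int CARD('p)"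
    using range_to_int_mod_ring[where 'a='p] by (metis atLeastLessThan_iff rangeI)+
  have p: "CARD('p) > 0" by simp
  from \<open>add_char c = 1\<close> have "cos (2 * pi * of_int ?t / CARD('p)) = 1"
    by (simp add: add_char_def complex_eq_iff)
  then obtain k :: int where "2 * pi * of_int ?t / CARD('p) = of_int k * 2 * pi"
    by (auto simp: cos_one_2pi_int)
  then have "of_int ?t = of_int k * (of_nat CARD('p) :: real)"
    using p by (simp add: field_simps)
  then have *: "?t = k * int CARD('p)"
    by (metis of_int_eq_iff of_int_mult of_int_of_nat_eq)
  have "k = 0"
    using t p unfolding * by (simp add: zero_le_mult_iff)
  with * show "c = 0" by simp
qed simp

text \<open>Translation by some \<open>u\<close> with \<open>\<phi> u \<noteq> 1\<close> permutes
  the carrier and multiplies the sum by \<open>\<phi> u\<close>, so the sum vanishes. The abstract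
  form also serves characters built from an additive map in
  \<open>exists_aligned_coeff\<close>.\<close>

lemma sum_character_carrier_vec:
  fixes \<phi> :: "'p::prime_card mod_ring vec \<Rightarrow> complex"
  assumes mult: "\<And>u v. u \<in> carrier_vec n \<Longrightarrow> v \<in> carrier_vec n \<Longrightarrow> \<phi> (u + v) = \<phi> u * \<phi> v"
  shows "(\<Sum>v\<in>carrier_vec n. \<phi> v) =
    (if \<forall>v\<in>carrier_vec n. \<phi> v = 1 then of_nat (card (carrier_vec n :: 'p mod_ring vec set)) else 0)"
proof (cases "\<forall>v\<in>carrier_vec n. \<phi> v = 1")
  case False
  then obtain u where u: "u \<in> carrier_vec n" "\<phi> u \<noteq> 1" by blast
  have "(\<Sum>v\<in>carrier_vec n. \<phi> v) = (\<Sum>v\<in>carrier_vec n. \<phi> (u + v))"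
    using u by (intro sum.reindex_bij_witness[of _ "\<lambda>v. u + v" "\<lambda>v. v - u"])
      (auto simp: vec_eq_iff intro!: arg_cong[of _ _ \<phi>])
  also have "\<dots> = \<phi> u * (\<Sum>v\<in>carrier_vec n. \<phi> v)"
    using u by (simp add: mult sum_distrib_left)
  finally show ?thesis using u False by auto
qed simp

lemma scalar_prod_nondegenerate:
  assumes "x \<in> carrier_vec n" and "\<And>v. v \<in> carrier_vec n \<Longrightarrow> v \<bullet> x = (0 :: 'a::comm_ring_1)"
  shows "x = 0\<^sub>v n"
proof (rule eq_vecI)
  fix i assume "i < dim_vec (0\<^sub>v n :: 'a vec)"
  then show "x $ i = 0\<^sub>v n $ i"
    using assms(2)[of "unit_vec n i"] assms(1) by simp
qed (use assms in auto)

lemma sum_add_char_scalar_prod: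
  fixes x :: "'p::prime_card mod_ring vec"
  assumes "x \<in> carrier_vec n"
  shows "(\<Sum>v\<in>carrier_vec n. add_char (v \<bullet> x)) =
    (if x = 0\<^sub>v n then of_nat (card (carrier_vec n :: 'p mod_ring vec set)) else 0)"
proof -
  have "(\<forall>v\<in>carrier_vec n. add_char (v \<bullet> x) = 1) \<longleftrightarrow> x = 0\<^sub>v n"
    using assms scalar_prod_nondegenerate[of x n] by (auto simp: add_char_eq_1_iff)
  then show ?thesis
    using sum_character_carrier_vec[of n "\<lambda>v. add_char (v \<bullet> x)"] assms
    by (simp add: add_scalar_prod_distrib add_char_add)
qed

lemma sum_add_char_scalar_prod_diff:
  fixes x y :: "'p::prime_card mod_ring vec"
  assumes "x \<in> carrier_vec n" "y \<in> carrier_vec n"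
  shows "(\<Sum>v\<in>carrier_vec n. add_char (v \<bullet> x) * cnj (add_char (v \<bullet> y))) =
    of_nat (card (carrier_vec n :: 'p mod_ring vec set)) * of_bool (x = y)"
proof -
  have "x - y = 0\<^sub>v n \<longleftrightarrow> x = y"
    using assms by (auto simp: vec_eq_iff)
  then show ?thesis
    using sum_add_char_scalar_prod[of "x - y" n] assms
    by (simp add: scalar_prod_minus_distrib add_char_diff)
qed

text \<open>For \<open>c \<noteq> 0\<close>, shifting \<open>s\<close> by \<open>inverse c\<close>
  multiplies the sum by \<open>add_char 1\<close>, which differs from 1.\<close>

lemma sum_UNIV_add_char:
  fixes c :: "'p::prime_card mod_ring"
  shows "(\<Sum>s\<in>UNIV. add_char (s * c)) = of_bool (c = 0) * of_nat CARD('p)"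
proof (cases "c = 0")
  case False
  have "(\<Sum>s\<in>UNIV. add_char (s * c)) = (\<Sum>s\<in>UNIV. add_char ((s + inverse c) * c))"
    by (rule sum.reindex_bij_witness[of _ "\<lambda>v. v + inverse c" "\<lambda>v. v - inverse c"]) auto
  also have "\<dots> = add_char (1 :: 'p mod_ring) * (\<Sum>s\<in>UNIV. add_char (s * c))"
    using False by (simp add: ring_distribs add_char_add mult.commute flip: sum_distrib_left)
  finally have "add_char (1 :: 'p mod_ring) = 1 \<or> (\<Sum>s\<in>UNIV. add_char (s * c)) = 0"
    by auto
  with False show ?thesis by (simp add: add_char_eq_1_iff)
qed simp

text \<open>The mean of \<open>add_char (s * c)\<close> over all \<open>s \<noteq> 0\<close>.\<close>

definition unit_kernel :: "'p::prime_card mod_ring \<Rightarrow> real" where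
  "unit_kernel c = (if c = 0 then 1 else - 1 / (real CARD('p) - 1))"

lemma CARD_prime_ge_2: "CARD('p::prime_card) \<ge> 2"
  by (rule prime_ge_2_nat[OF prime_card])

lemma card_nonzero_mod_ring: "card (- {0 :: 'p::prime_card mod_ring}) = CARD('p) - 1"
  by (simp add: Compl_eq_Diff_UNIV card_Diff_singleton)

lemma sum_nonzero_add_char:
  "(\<Sum>s\<in>- {0}. add_char (s * c)) = of_nat (CARD('p) - 1) * of_real (unit_kernel (c :: 'p::prime_card mod_ring))"
proof -
  have "(\<Sum>s\<in>- {0}. add_char (s * c)) = (\<Sum>s\<in>UNIV. add_char (s * c)) - 1"
    by (simp add: Compl_eq_Diff_UNIV sum_diff)
  moreover have "real CARD('p) - 1 > 0" using CARD_prime_ge_2[where 'p='p] by linarith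
  ultimately show ?thesis
    by (auto simp: sum_UNIV_add_char unit_kernel_def of_nat_diff simp flip: of_nat_eq_0_iff)
qed

lemma unit_kernel_simps [simp]:
  "unit_kernel 0 = 1" "unit_kernel (- c) = unit_kernel c"
  "s \<noteq> 0 \<Longrightarrow> unit_kernel (s * c) = unit_kernel c"
  by (auto simp: unit_kernel_def)

text \<open>The lowest value \<open>- 1 / (p - 1)\<close> is at least -1, attained for
  \<open>p = 2\<close>; this is the source of the factor 2.\<close>

lemma unit_kernel_bounds:
  "\<bar>unit_kernel c\<bar> \<le> 1" "1 - unit_kernel c \<le> 2 * of_bool (c \<noteq> 0)"
  for c :: "'p::prime_card mod_ring"
proof -
  have "real CARD('p) - 1 \<ge> 1" using CARD_prime_ge_2[where 'p='p] by linarith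
  then show "\<bar>unit_kernel c\<bar> \<le> 1" "1 - unit_kernel c \<le> 2 * of_bool (c \<noteq> 0)"
    by (auto simp: unit_kernel_def field_simps)
qed

section \<open>Product sums over independent draws\<close>

lemma sum_prod_PiE_dflt:
  fixes g :: "'i \<Rightarrow> 'v \<Rightarrow> 'c::comm_semiring_1"
  assumes "finite A" "finite B"
  shows "(\<Sum>f\<in>PiE_dflt A d (\<lambda>_. B). \<Prod>i\<in>A. g i (f i)) = (\<Prod>i\<in>A. \<Sum>v\<in>B. g i v)"
proof -
  let ?h = "\<lambda>f i. if i \<in> A then f i else d"
  \<comment> \<open>Only the value outside \<open>A\<close> changes, from \<open>undefined\<close>
    to \<open>d\<close>, so the usual distributive law for \<open>PiE\<close> carries over.\<close>
  have "inj_on ?h (PiE A (\<lambda>_. B))"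
    by (rule inj_onI, rule PiE_ext, assumption, assumption) (meson fun_cong)
  then have "(\<Sum>f\<in>PiE_dflt A d (\<lambda>_. B). \<Prod>i\<in>A. g i (f i)) = (\<Sum>f\<in>PiE A (\<lambda>_. B). \<Prod>i\<in>A. g i (f i))"
    by (simp add: sum.reindex flip: dflt_image_PiE)
  also have "\<dots> = (\<Prod>i\<in>A. \<Sum>v\<in>B. g i v)"
    using assms by (simp add: prod_sum_PiE)
  finally show ?thesis .
qed

lemma card_PiE_dflt_const:
  assumes "finite A" "finite B"
  shows "card (PiE_dflt A d (\<lambda>_. B)) = card B ^ card A"
  using assms by (simp add: card_PiE_dflt)


lemma scalar_prod_finsum_vec:
  fixes b :: "'a::comm_semiring_0 vec"
  assumes "finite A" "b \<in> carrier_vec n" "g \<in> A \<rightarrow> carrier_vec n"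
  shows "b \<bullet> finsum_vec TYPE('a) n g A = (\<Sum>i\<in>A. b \<bullet> g i)"
  using assms
proof (induction A rule: finite_induct)
  case (insert i A)
  then have "g \<in> A \<rightarrow> carrier_vec n" "g i \<in> carrier_vec n" by auto
  with insert show ?case
    by (simp add: finsum_vec_insert scalar_prod_add_distrib finsum_vec_closed)
qed (simp add: finsum_vec_empty)

subsection \<open>Real and complex estimates\<close>

text \<open>Let \<open>M\<close> be the largest weight. The sum of squares is at most
  \<open>M\<close>, and the other terms have total norm at most \<open>1 - M\<close>, so the norm is
  at least \<open>2 * M - 1\<close>, whose square is at least \<open>4 * M - 3\<close>. If the sum
  of squares is at most 3/4, the bound is not positive.\<close>

lemma norm_weighted_sum_ge:
  fixes z :: "'a \<Rightarrow> complex"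
  assumes "finite A" and nonneg: "\<And>a. a \<in> A \<Longrightarrow> D a \<ge> 0" and le1: "sum D A \<le> 1"
    and z: "\<And>a. a \<in> A \<Longrightarrow> norm (z a) = 1"
  shows "(norm (\<Sum>a\<in>A. of_real (D a) * z a))\<^sup>2 \<ge> 4 * (\<Sum>a\<in>A. (D a)\<^sup>2) - 3"
proof (cases "(\<Sum>a\<in>A. (D a)\<^sup>2) > 3 / 4")
  case True
  then have "A \<noteq> {}" by auto
  define M where "M = Max (D ` A)"
  have "M \<in> D ` A" unfolding M_def using \<open>finite A\<close> \<open>A \<noteq> {}\<close> by (intro Max_in) auto
  then obtain c where c: "c \<in> A" "D c = M" by auto
  have max: "D a \<le> M" if "a \<in> A" for a unfolding M_def using \<open>finite A\<close> that by simp
  have "(\<Sum>a\<in>A. (D a)\<^sup>2) \<le> (\<Sum>a\<in>A. M * D a)"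
    unfolding power2_eq_square by (intro sum_mono mult_right_mono max nonneg)
  also have "\<dots> \<le> M"
    using c nonneg[of c] le1 by (simp add: mult_left_le flip: sum_distrib_left)
  finally have M: "(\<Sum>a\<in>A. (D a)\<^sup>2) \<le> M" .
  have "norm (\<Sum>a\<in>A - {c}. of_real (D a) * z a) \<le> (\<Sum>a\<in>A - {c}. D a)"
    by (rule order.trans[OF norm_sum]) (auto intro!: sum_mono simp: norm_mult z nonneg)
  also have "\<dots> \<le> 1 - M"
    using le1 c \<open>finite A\<close> by (simp add: sum_diff1)
  finally have *: "norm (\<Sum>a\<in>A - {c}. of_real (D a) * z a) \<le> 1 - M" .
  have "(\<Sum>a\<in>A. of_real (D a) * z a) = of_real M * z c + (\<Sum>a\<in>A - {c}. of_real (D a) * z a)"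
    using c \<open>finite A\<close> by (simp add: sum.remove)
  then have "norm (\<Sum>a\<in>A. of_real (D a) * z a) \<ge> norm (of_real M * z c) - norm (\<Sum>a\<in>A - {c}. of_real (D a) * z a)"
    by (metis norm_diff_ineq)
  moreover have "norm (of_real M * z c) = M"
    using c nonneg[of c] z by (simp add: norm_mult)
  ultimately have "norm (\<Sum>a\<in>A. of_real (D a) * z a) \<ge> 2 * M - 1"
    using * by linarith
  then have "(norm (\<Sum>a\<in>A. of_real (D a) * z a))\<^sup>2 \<ge> (2 * M - 1)\<^sup>2"
    using True M by (intro power_mono) auto
  moreover have "(2 * M - 1)\<^sup>2 = 4 * M - 3 + 4 * (1 - M)\<^sup>2"
    by (simp add: power2_eq_square algebra_simps)
  ultimately show ?thesis using M zero_le_power2[of "1 - M"] by linarith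
qed (use zero_le_power2[of "norm (\<Sum>a\<in>A. of_real (D a) * z a)"] in linarith)

text \<open>For the largest weight \<open>M\<close>, all other weights are at most
  \<open>1 - M\<close>, so the sum of squares is at most
  \<open>M * M + (1 - M) * (1 - M)\<close>.\<close>

lemma exists_large_weight:
  fixes D :: "'a \<Rightarrow> real"
  assumes "finite A" and nonneg: "\<And>a. a \<in> A \<Longrightarrow> D a \<ge> 0" and eq1: "sum D A = 1"
    and sq: "(\<Sum>a\<in>A. (D a)\<^sup>2) > 3 / 4"
  shows "\<exists>a\<in>A. D a > 4 / 5"
proof -
  have "A \<noteq> {}" using sq by auto
  define M where "M = Max (D ` A)"
  have "M \<in> D ` A" unfolding M_def using \<open>finite A\<close> \<open>A \<noteq> {}\<close> by (intro Max_in) auto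
  then obtain c where c: "c \<in> A" "D c = M" by auto
  have max: "D a \<le> M" if "a \<in> A" for a unfolding M_def using \<open>finite A\<close> that by simp
  have "(\<Sum>a\<in>A. (D a)\<^sup>2) \<le> (\<Sum>a\<in>A. M * D a)"
    unfolding power2_eq_square by (intro sum_mono mult_right_mono max nonneg)
  then have M: "M > 3 / 4"
    using sq eq1 by (simp flip: sum_distrib_left)
  have rest: "(\<Sum>a\<in>A - {c}. D a) = 1 - M"
    using eq1 c \<open>finite A\<close> by (simp add: sum_diff1)
  have "(\<Sum>a\<in>A - {c}. (D a)\<^sup>2) \<le> (\<Sum>a\<in>A - {c}. (1 - M) * D a)"
    unfolding power2_eq_square
  proof (intro sum_mono mult_right_mono)
    fix a assume a: "a \<in> A - {c}"
    then show "D a \<le> 1 - M"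
      unfolding rest[symmetric] using \<open>finite A\<close> nonneg by (intro member_le_sum) auto
  qed (use nonneg in auto)
  also have "\<dots> = (1 - M) * (1 - M)"
    by (simp add: rest flip: sum_distrib_left)
  finally have "M * M + (1 - M) * (1 - M) > 3 / 4"
    using sq c \<open>finite A\<close> by (simp add: sum.remove[of A c] power2_eq_square)
  \<comment> \<open>This bounds \<open>M * M\<close> by a linear expression on the interval from 3/4
    to 4/5, where linear arithmetic then gives a contradiction.\<close>
  moreover have "(M - 3 / 4) * (M - 4 / 5) \<le> 0" if "M \<le> 4 / 5"
    using M that by (intro mult_nonneg_nonpos) auto
  ultimately have "M > 4 / 5"
    using M by (force simp: algebra_simps)
  with c show ?thesis by auto
qed

text \<open>Expand the squared modulus of \<open>z + cnj u - 2\<close>, which is nonnegative. This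
  is the pointwise form of \<open>dens_add\<close>.\<close>

lemma Re_mult_unit_ge:
  fixes z u :: complex
  assumes "norm z = 1" "norm u = 1"
  shows "Re (z * u) \<ge> 2 * Re z + 2 * Re u - 3"
proof -
  have z: "(Re z)\<^sup>2 + (Im z)\<^sup>2 = 1" and u: "(Re u)\<^sup>2 + (Im u)\<^sup>2 = 1"
    using assms by (metis cmod_power2 one_power2)+
  have "0 \<le> (Re z + Re u - 2)\<^sup>2 + (Im z - Im u)\<^sup>2" by simp
  then show ?thesis
    using z u by (simp add: power2_eq_square algebra_simps)
qed

text \<open>By Bernoulli, \<open>1 + N * t\<close> is at most \<open>(1 + t) ^ N\<close>, and
  \<open>(1 - t) * (1 + t) \<le> 1\<close>.\<close>

lemma power_diff_one_le:
  fixes t :: real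
  assumes "0 \<le> t" "t \<le> 1"
  shows "(1 - t) ^ N * (1 + real N * t) \<le> 1"
proof -
  have "(1 - t) ^ N * (1 + real N * t) \<le> (1 - t) ^ N * (1 + t) ^ N"
    using assms by (intro mult_left_mono Bernoulli_inequality) auto
  also have "\<dots> = (1 - t * t) ^ N"
    by (simp add: algebra_simps flip: power_mult_distrib)
  also have "\<dots> \<le> 1"
    using assms by (intro power_le_one) (auto simp: mult_le_one)
  finally show ?thesis .
qed

text \<open>The other squares total at most 2/5, so \<open>c a\<close> is largest in modulus. If it
  is nonnegative, \<open>c a ^ N\<close> bounds every \<open>c x ^ N\<close> and the squares left
  over sum to at most 1. If it is negative, so is its odd power, and the squares bound the
  rest.\<close>

lemma sum_odd_power_le:
  fixes c :: "'a \<Rightarrow> real"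
  assumes "finite A" "a \<in> A" and sq: "(\<Sum>x\<in>A. (c x)\<^sup>2) \<le> 1" and a: "(c a)\<^sup>2 \<ge> 3 / 5"
    and N: "odd N"
  shows "c a \<ge> 0 \<Longrightarrow> (\<Sum>x\<in>A. c x ^ (N + 2)) \<le> c a ^ N"
    and "c a < 0 \<Longrightarrow> (\<Sum>x\<in>A. c x ^ (N + 2)) \<le> 2 / 5"
proof -
  have rest: "(\<Sum>x\<in>A - {a}. (c x)\<^sup>2) \<le> 2 / 5"
    using assms by (simp add: sum.remove[of A a])
  have le: "(c x)\<^sup>2 \<le> 2 / 5" if "x \<in> A" "x \<noteq> a" for x
    using rest that \<open>finite A\<close> member_le_sum[of x "A - {a}" "\<lambda>x. (c x)\<^sup>2"] by force
  show "(\<Sum>x\<in>A. c x ^ (N + 2)) \<le> c a ^ N" if "c a \<ge> 0"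
  proof -
    have "\<bar>c x\<bar> \<le> c a" if "x \<in> A" for x
    proof (cases "x = a")
      case False
      then have "(c x)\<^sup>2 \<le> (c a)\<^sup>2" using le[OF that] a by linarith
      then show ?thesis using \<open>c a \<ge> 0\<close> by (simp flip: abs_le_square_iff)
    qed (use \<open>c a \<ge> 0\<close> in simp)
    then have "c x ^ N \<le> c a ^ N" if "x \<in> A" for x
      using power_mono[of "\<bar>c x\<bar>" "c a" N] that abs_ge_self[of "c x ^ N"]
      by (force simp: power_abs)
    then have "(\<Sum>x\<in>A. c x ^ (N + 2)) \<le> (\<Sum>x\<in>A. c a ^ N * (c x)\<^sup>2)"
      unfolding power_add by (intro sum_mono mult_right_mono) auto
    also have "\<dots> \<le> c a ^ N"
      using sq that by (simp add: mult_left_le flip: sum_distrib_left)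
    finally show ?thesis .
  qed
  show "(\<Sum>x\<in>A. c x ^ (N + 2)) \<le> 2 / 5" if "c a < 0"
  proof -
    have "c x ^ (N + 2) \<le> (c x)\<^sup>2" if "x \<in> A - {a}" for x
    proof -
      have "\<bar>c x\<bar> \<le> 1"
        using le[of x] that by (simp flip: abs_square_le_1)
      then have "c x ^ N \<le> 1"
        using power_le_one[of "\<bar>c x\<bar>" N] abs_ge_self[of "c x ^ N"] by (simp add: power_abs)
      then show ?thesis
        unfolding power_add using mult_right_mono[of "c x ^ N" 1 "(c x)\<^sup>2"] by simp
    qed
    then have "(\<Sum>x\<in>A - {a}. c x ^ (N + 2)) \<le> (\<Sum>x\<in>A - {a}. (c x)\<^sup>2)"
      by (rule sum_mono)
    moreover have "c a ^ (N + 2) < 0"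
      using that N by (subst power_less_zero_eq) auto
    ultimately show ?thesis
      using rest assms(1,2) by (simp add: sum.remove[of A a])
  qed
qed

lemma of_real_of_bool: "of_real (of_bool P) = of_bool P"
  by (cases P) auto

subsection \<open>The acceptance probability as a power sum of Fourier coefficients\<close>

locale vec_map =
  fixes n r :: nat and f :: "'p::prime_card mod_ring vec \<Rightarrow> 'p mod_ring vec"
  assumes f_closed: "x \<in> carrier_vec n \<Longrightarrow> f x \<in> carrier_vec r"
begin

abbreviation V :: "'p mod_ring vec set" where "V \<equiv> carrier_vec n"
abbreviation W :: "'p mod_ring vec set" where "W \<equiv> carrier_vec r"
abbreviation S :: "'p mod_ring set" where "S \<equiv> - {0}"

lemma finite_VW [simp]: "finite V" "finite W"
  by (rule finite_carrier_vec_mod_ring)+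

lemma card_pos [simp]: "card V > 0" "card W > 0" "card S > 0"
proof -
  have "0\<^sub>v n \<in> V" "0\<^sub>v r \<in> W" "1 \<in> S" by simp_all
  then show "card V > 0" "card W > 0" "card S > 0"
    by (metis card_gt_0_iff emptyE finite_VW finite_nonzero_mod_ring(1))+
qed

lemma card_nonzero [simp]: "card V \<noteq> 0" "card W \<noteq> 0" "card S \<noteq> 0"
  using card_pos by (simp_all only: neq0_conv)

text \<open>The linear functional \<open>(b, a)\<close> evaluated at the graph point
  \<open>(f x, x)\<close>.\<close>

definition lin :: "'p mod_ring vec \<Rightarrow> 'p mod_ring vec \<Rightarrow> 'p mod_ring vec \<Rightarrow> 'p mod_ring" where
  "lin b a x = b \<bullet> f x + a \<bullet> x"

definition fcoeff :: "'p mod_ring vec \<Rightarrow> 'p mod_ring vec \<Rightarrow> real" where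
  "fcoeff b a = (\<Sum>x\<in>V. unit_kernel (lin b a x)) / card V"

lemma lin_smult:
  assumes "b \<in> W" "a \<in> V" "x \<in> V"
  shows "lin (s \<cdot>\<^sub>v b) (s \<cdot>\<^sub>v a) x = s * lin b a x"
  using assms f_closed by (simp add: lin_def ring_distribs)

lemma sum_add_char_lin:
  "(\<Sum>s\<in>S. add_char (s * c)) = of_nat (card S) * of_real (unit_kernel (c :: 'p mod_ring))"
  by (simp add: sum_nonzero_add_char card_nonzero_mod_ring)

lemma sum_unit_kernel_lin: "(\<Sum>x\<in>V. unit_kernel (lin b a x)) = card V * fcoeff b a"
  by (simp add: fcoeff_def)

lemma abs_fcoeff_le_1: "\<bar>fcoeff b a\<bar> \<le> 1"
proof -
  have "\<bar>\<Sum>x\<in>V. unit_kernel (lin b a x)\<bar> \<le> (\<Sum>x\<in>V. 1)"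
    by (rule order.trans[OF sum_abs]) (intro sum_mono unit_kernel_bounds)
  then show ?thesis by (simp add: fcoeff_def abs_divide field_simps)
qed

lemma fcoeff_smult:
  assumes "s \<noteq> 0" "b \<in> W" "a \<in> V"
  shows "fcoeff (s \<cdot>\<^sub>v b) (s \<cdot>\<^sub>v a) = fcoeff b a"
  using assms by (simp add: fcoeff_def lin_smult)

definition accepts :: "nat \<Rightarrow> (nat \<Rightarrow> 'p mod_ring vec) \<Rightarrow> (nat \<Rightarrow> 'p mod_ring) \<Rightarrow> bool" where
  "accepts m x \<sigma> \<longleftrightarrow> finsum_vec TYPE('p mod_ring) r (\<lambda>i. \<sigma> i \<cdot>\<^sub>v f (x i)) {1..m} =
     f (finsum_vec TYPE('p mod_ring) n (\<lambda>i. \<sigma> i \<cdot>\<^sub>v x i) {1..m})"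

text \<open>With \<open>u\<close> and \<open>v\<close> the combinations of the values and of the
  points, the test accepts iff \<open>(u, v) = (f y, y)\<close> for some \<open>y\<close>, which is
  then \<open>v\<close>. Orthogonality on \<open>W\<close> and \<open>V\<close> detects the two
  equations.\<close>

lemma accepts_fourier:
  assumes x: "\<And>i. i \<in> {1..m} \<Longrightarrow> x i \<in> V"
  shows "of_nat (card V * card W) * of_bool (accepts m x \<sigma>) =
    (\<Sum>b\<in>W. \<Sum>a\<in>V. \<Sum>y\<in>V. (\<Prod>i\<in>{1..m}. add_char (\<sigma> i * lin b a (x i))) * cnj (add_char (lin b a y)))"
proof -
  define u where "u = finsum_vec TYPE('p mod_ring) r (\<lambda>i. \<sigma> i \<cdot>\<^sub>v f (x i)) {1..m}"
  define v where "v = finsum_vec TYPE('p mod_ring) n (\<lambda>i. \<sigma> i \<cdot>\<^sub>v x i) {1..m}"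
  have fx: "f (x i) \<in> W" if "i \<in> {1..m}" for i using x f_closed that by auto
  have u: "u \<in> W" and v: "v \<in> V"
    unfolding u_def v_def using x fx by (intro finsum_vec_closed; simp)+
  have "(\<Prod>i\<in>{1..m}. add_char (\<sigma> i * lin b a (x i))) = add_char (b \<bullet> u) * add_char (a \<bullet> v)"
    if "b \<in> W" "a \<in> V" for b a
  proof -
    have "b \<bullet> u = (\<Sum>i\<in>{1..m}. \<sigma> i * (b \<bullet> f (x i)))"
      unfolding u_def using that fx by (subst scalar_prod_finsum_vec) auto
    moreover have "a \<bullet> v = (\<Sum>i\<in>{1..m}. \<sigma> i * (a \<bullet> x i))"
      unfolding v_def using that x by (subst scalar_prod_finsum_vec) auto
    ultimately have "b \<bullet> u + a \<bullet> v = (\<Sum>i\<in>{1..m}. \<sigma> i * lin b a (x i))"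
      by (simp add: lin_def ring_distribs sum.distrib)
    then show ?thesis by (simp flip: add_char_add add_char_sum)
  qed
  then have "(\<Sum>b\<in>W. \<Sum>a\<in>V. \<Sum>y\<in>V. (\<Prod>i\<in>{1..m}. add_char (\<sigma> i * lin b a (x i))) * cnj (add_char (lin b a y)))
    = (\<Sum>b\<in>W. \<Sum>a\<in>V. \<Sum>y\<in>V. (add_char (b \<bullet> u) * cnj (add_char (b \<bullet> f y))) * (add_char (a \<bullet> v) * cnj (add_char (a \<bullet> y))))"
    by (intro sum.cong refl) (simp add: lin_def add_char_add)
  also have "\<dots> = (\<Sum>b\<in>W. \<Sum>y\<in>V. \<Sum>a\<in>V. (add_char (b \<bullet> u) * cnj (add_char (b \<bullet> f y))) * (add_char (a \<bullet> v) * cnj (add_char (a \<bullet> y))))"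
    by (intro sum.cong refl sum.swap)
  also have "\<dots> = (\<Sum>y\<in>V. \<Sum>b\<in>W. \<Sum>a\<in>V. (add_char (b \<bullet> u) * cnj (add_char (b \<bullet> f y))) * (add_char (a \<bullet> v) * cnj (add_char (a \<bullet> y))))"
    by (rule sum.swap)
  also have "\<dots> = (\<Sum>y\<in>V. (\<Sum>b\<in>W. add_char (b \<bullet> u) * cnj (add_char (b \<bullet> f y))) * (\<Sum>a\<in>V. add_char (a \<bullet> v) * cnj (add_char (a \<bullet> y))))"
    by (simp add: sum_product)
  also have "\<dots> = (\<Sum>y\<in>V. (of_nat (card V * card W) * of_bool (u = f y)) * of_bool (v = y))"
    using u v f_closed by (intro sum.cong refl) (simp add: sum_add_char_scalar_prod_diff)
  also have "\<dots> = of_nat (card V * card W) * of_bool (u = f v)"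
    using v by (subst sum.mono_neutral_right[of _ "{v}"]) auto
  finally show ?thesis by (simp add: accepts_def u_def v_def)
qed

text \<open>Scaling \<open>(b, a)\<close> by \<open>s \<noteq> 0\<close> does not change \<open>fcoeff\<close>, so the last factor may be averaged over \<open>s\<close>.\<close>

lemma sum_lin_symmetrize:
  assumes "y \<in> V"
  shows "(\<Sum>b\<in>W. \<Sum>a\<in>V. of_real (fcoeff b a ^ m) * cnj (add_char (lin b a y))) =
    of_real (\<Sum>b\<in>W. \<Sum>a\<in>V. fcoeff b a ^ m * unit_kernel (lin b a y))"
proof -
  let ?T = "\<lambda>s. \<Sum>b\<in>W. \<Sum>a\<in>V. of_real (fcoeff b a ^ m) * cnj (add_char (s * lin b a y))"
  have "?T s = ?T 1" if "s \<in> S" for s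
  proof -
    from that have s: "s \<noteq> 0" by simp
    have "?T 1 = (\<Sum>(b, a)\<in>W \<times> V. of_real (fcoeff b a ^ m) * cnj (add_char (lin b a y)))"
      by (simp add: sum.cartesian_product)
    also have "\<dots> = (\<Sum>(b, a)\<in>W \<times> V. of_real (fcoeff b a ^ m) * cnj (add_char (s * lin b a y)))"
      using s assms
      by (intro sum.reindex_bij_witness[of _ "\<lambda>(b, a). (s \<cdot>\<^sub>v b, s \<cdot>\<^sub>v a)" "\<lambda>(b, a). (inverse s \<cdot>\<^sub>v b, inverse s \<cdot>\<^sub>v a)"])
        (auto simp: smult_smult_assoc fcoeff_smult lin_smult simp flip: mult.assoc)
    finally show ?thesis by (simp add: sum.cartesian_product)
  qed
  then have "of_nat (card S) * ?T 1 = (\<Sum>s\<in>S. ?T s)"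
    by simp
  also have "\<dots> = (\<Sum>b\<in>W. \<Sum>a\<in>V. \<Sum>s\<in>S. of_real (fcoeff b a ^ m) * cnj (add_char (s * lin b a y)))"
    by (subst sum.swap) (intro sum.cong refl sum.swap)
  also have "\<dots> = (\<Sum>b\<in>W. \<Sum>a\<in>V. of_nat (card S) * of_real (fcoeff b a ^ m * unit_kernel (lin b a y)))"
    by (intro sum.cong refl) (simp add: sum_add_char_lin flip: sum_distrib_left cnj_sum)
  also have "\<dots> = of_nat (card S) * of_real (\<Sum>b\<in>W. \<Sum>a\<in>V. fcoeff b a ^ m * unit_kernel (lin b a y))"
    by (simp add: sum_distrib_left)
  finally show ?thesis by simp
qed

text \<open>This turns out to be the acceptance probability (\<open>prob_reject\<close>).\<close>

definition acceptance :: "nat \<Rightarrow> real" where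
  "acceptance m = (\<Sum>b\<in>W. \<Sum>a\<in>V. fcoeff b a ^ (m + 1)) / card W"

text \<open>For fixed \<open>(b, a)\<close> the draws are independent, so each of the
  \<open>m\<close> indices contributes a factor \<open>fcoeff b a\<close>. The sum over the graph
  point \<open>y\<close>, once symmetrized, contributes one more.\<close>

lemma sum_accepts:
  fixes d :: "'p mod_ring vec" and d' :: "'p mod_ring"
  shows "(\<Sum>x\<in>PiE_dflt {1..m} d (\<lambda>_. V). \<Sum>\<sigma>\<in>PiE_dflt {1..m} d' (\<lambda>_. S). of_bool (accepts m x \<sigma>)) =
    real (card V ^ m * card S ^ m) * acceptance m"
proof -
  let ?P = "PiE_dflt {1..m} d (\<lambda>_. V)" and ?Q = "PiE_dflt {1..m} d' (\<lambda>_. S)"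
  let ?G = "\<lambda>b a. \<Sum>x\<in>?P. \<Sum>\<sigma>\<in>?Q. \<Prod>i\<in>{1..m}. add_char (\<sigma> i * lin b a (x i))"
  have G: "?G b a = of_nat (card V ^ m * card S ^ m) * of_real (fcoeff b a ^ m)" for b a
  proof -
    have "?G b a = (\<Sum>x\<in>?P. \<Prod>i\<in>{1..m}. \<Sum>s\<in>S. add_char (s * lin b a (x i)))"
      by (intro sum.cong refl) (simp add: sum_prod_PiE_dflt[where g = "\<lambda>i s. add_char (s * lin b a (_ i))"])
    also have "\<dots> = (\<Prod>i\<in>{1..m}. \<Sum>x\<in>V. of_nat (card S) * of_real (unit_kernel (lin b a x)))"
      unfolding sum_add_char_lin by (subst sum_prod_PiE_dflt) auto
    also have "\<dots> = (of_nat (card S) * of_real (\<Sum>x\<in>V. unit_kernel (lin b a x))) ^ m"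
      by (simp flip: sum_distrib_left)
    finally show ?thesis
      by (simp add: sum_unit_kernel_lin power_mult_distrib)
  qed
  have "of_nat (card V * card W) * (\<Sum>x\<in>?P. \<Sum>\<sigma>\<in>?Q. of_bool (accepts m x \<sigma>)) =
    (\<Sum>x\<in>?P. \<Sum>\<sigma>\<in>?Q. of_nat (card V * card W) * (of_bool (accepts m x \<sigma>) :: complex))"
    by (simp add: sum_distrib_left)
  also have "\<dots> = (\<Sum>x\<in>?P. \<Sum>\<sigma>\<in>?Q. \<Sum>b\<in>W. \<Sum>a\<in>V. \<Sum>y\<in>V.
      (\<Prod>i\<in>{1..m}. add_char (\<sigma> i * lin b a (x i))) * cnj (add_char (lin b a y)))"
    by (intro sum.cong refl accepts_fourier) (auto simp: PiE_dflt_def)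
  also have "\<dots> = (\<Sum>x\<in>?P. \<Sum>b\<in>W. \<Sum>a\<in>V. \<Sum>y\<in>V. \<Sum>\<sigma>\<in>?Q.
      (\<Prod>i\<in>{1..m}. add_char (\<sigma> i * lin b a (x i))) * cnj (add_char (lin b a y)))"
    \<comment> \<open>Fixing the outer index set moves this one sum inwards past all others and
      keeps the rewriting from looping.\<close>
    by (simp only: sum.swap[of _ _ ?Q])
  also have "\<dots> = (\<Sum>b\<in>W. \<Sum>a\<in>V. \<Sum>y\<in>V. \<Sum>x\<in>?P. \<Sum>\<sigma>\<in>?Q.
      (\<Prod>i\<in>{1..m}. add_char (\<sigma> i * lin b a (x i))) * cnj (add_char (lin b a y)))"
    by (simp only: sum.swap[of _ _ ?P])
  also have "\<dots> = (\<Sum>b\<in>W. \<Sum>a\<in>V. \<Sum>y\<in>V. of_nat (card V ^ m * card S ^ m) * (of_real (fcoeff b a ^ m) * cnj (add_char (lin b a y))))"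
    unfolding sum_distrib_right[symmetric] G by (simp add: mult.assoc)
  also have "\<dots> = (\<Sum>b\<in>W. \<Sum>y\<in>V. \<Sum>a\<in>V. of_nat (card V ^ m * card S ^ m) * (of_real (fcoeff b a ^ m) * cnj (add_char (lin b a y))))"
    by (intro sum.cong refl sum.swap)
  also have "\<dots> = (\<Sum>y\<in>V. \<Sum>b\<in>W. \<Sum>a\<in>V. of_nat (card V ^ m * card S ^ m) * (of_real (fcoeff b a ^ m) * cnj (add_char (lin b a y))))"
    by (rule sum.swap)
  also have "\<dots> = of_nat (card V ^ m * card S ^ m) * (\<Sum>y\<in>V. \<Sum>b\<in>W. \<Sum>a\<in>V. of_real (fcoeff b a ^ m) * cnj (add_char (lin b a y)))"
    by (simp only: sum_distrib_left)
  also have "(\<Sum>y\<in>V. \<Sum>b\<in>W. \<Sum>a\<in>V. of_real (fcoeff b a ^ m) * cnj (add_char (lin b a y))) =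
      of_real (\<Sum>y\<in>V. \<Sum>b\<in>W. \<Sum>a\<in>V. fcoeff b a ^ m * unit_kernel (lin b a y))"
    by (simp only: of_real_sum[of _ V, symmetric] sum_lin_symmetrize cong: sum.cong)
  also have "(\<Sum>y\<in>V. \<Sum>b\<in>W. \<Sum>a\<in>V. fcoeff b a ^ m * unit_kernel (lin b a y)) =
      (\<Sum>b\<in>W. \<Sum>a\<in>V. \<Sum>y\<in>V. fcoeff b a ^ m * unit_kernel (lin b a y))"
    by (subst sum.swap) (intro sum.cong refl sum.swap)
  also have "\<dots> = (\<Sum>b\<in>W. \<Sum>a\<in>V. card V * fcoeff b a ^ (m + 1))"
    by (intro sum.cong refl) (simp only: sum_distrib_left[symmetric] sum_unit_kernel_lin, simp)
  also have "\<dots> = real (card V * card W) * acceptance m"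
    by (simp only: acceptance_def sum_distrib_left[symmetric]) simp
  finally have "complex_of_real (real (card V * card W) * (\<Sum>x\<in>?P. \<Sum>\<sigma>\<in>?Q. of_bool (accepts m x \<sigma>))) =
    of_real (real (card V * card W) * (real (card V ^ m * card S ^ m) * acceptance m))"
    by (simp add: mult_ac of_real_of_bool)
  then show ?thesis
    by (simp only: of_real_eq_iff) simp
qed

text \<open>Independent uniform components are jointly uniform on the product set, so
  \<open>sum_accepts\<close> counts the accepting draws.\<close>

lemma prob_reject:
  "measure_pmf.prob (random_coefficients_test m n r f) {False} = 1 - acceptance m"
proof -
  let ?P = "PiE_dflt {1..m} (0\<^sub>v n) (\<lambda>_. V)" and ?Q = "PiE_dflt {1..m} 0 (\<lambda>_. S)"
  have P: "finite ?P" "?P \<noteq> {}" and Q: "finite ?Q" "?Q \<noteq> {}"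
    by (auto simp: finite_nonzero_mod_ring PiE_dflt_empty_iff finite_carrier_vec_mod_ring)
  have eq: "random_coefficients_test m n r f =
    pmf_of_set ?P \<bind> (\<lambda>x. pmf_of_set ?Q \<bind> (\<lambda>\<sigma>. return_pmf (accepts m x \<sigma>)))"
    unfolding random_coefficients_test_def accepts_def Let_def
    by (simp add: Pi_pmf_of_set finite_carrier_vec_mod_ring finite_nonzero_mod_ring)
  have "measure_pmf.prob (random_coefficients_test m n r f) {True} =
    (\<Sum>x\<in>?P. \<Sum>\<sigma>\<in>?Q. of_bool (accepts m x \<sigma>)) / (card ?Q * card ?P)"
    unfolding eq using P Q
    by (simp add: measure_pmf_single pmf_bind integral_pmf_of_set indicator_def mult.commute flip: sum_divide_distrib)
  also have "\<dots> = acceptance m"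
    by (subst sum_accepts) (simp add: card_PiE_dflt_const)
  also have "{True} = - {False}" by auto
  finally show ?thesis
    using measure_pmf.prob_compl[of "{False}" "random_coefficients_test m n r f"]
    by (simp add: Compl_eq_Diff_UNIV)
qed

subsection \<open>The two-term density and its positive definiteness\<close>

text \<open>Elements of \<open>I\<close> index the scaled graph points \<open>(c x, c f x)\<close> with \<open>c \<noteq> 0\<close>.\<close>

abbreviation I :: "('p mod_ring vec \<times> 'p mod_ring) set" where "I \<equiv> V \<times> S"

definition gpoint :: "'p mod_ring vec \<times> 'p mod_ring \<Rightarrow> 'p mod_ring vec" where
  "gpoint z = snd z \<cdot>\<^sub>v fst z"

definition gvalue :: "'p mod_ring vec \<times> 'p mod_ring \<Rightarrow> 'p mod_ring vec" where
  "gvalue z = snd z \<cdot>\<^sub>v f (fst z)"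

lemma gpoint_gvalue_closed [simp]: "z \<in> I \<Longrightarrow> gpoint z \<in> V" "z \<in> I \<Longrightarrow> gvalue z \<in> W"
  by (auto simp: gpoint_def gvalue_def f_closed)

text \<open>The conditional probability \<open>N(s, w)\<close>: the event \<open>c x + d y = s\<close> has probability \<open>1 / card V\<close>.\<close>

definition dens :: "'p mod_ring vec \<Rightarrow> 'p mod_ring vec \<Rightarrow> real" where
  "dens s w = real (card V) * (\<Sum>z\<in>I. \<Sum>z'\<in>I. of_bool (gvalue z + gvalue z' = w) * of_bool (gpoint z + gpoint z' = s)) / (card I)\<^sup>2"

lemma dens_nonneg: "dens s w \<ge> 0"
  unfolding dens_def by (intro divide_nonneg_nonneg mult_nonneg_nonneg sum_nonneg zero_le_power2 of_nat_0_le_iff)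
    simp_all

text \<open>Identifies \<open>fcoeff\<close> as the characteristic function of a uniformly random
  scaled graph point.\<close>

lemma fcoeff_fourier:
  assumes "b \<in> W" "a \<in> V"
  shows "of_nat (card I) * of_real (fcoeff b a) = (\<Sum>z\<in>I. add_char (b \<bullet> gvalue z) * add_char (a \<bullet> gpoint z))"
proof -
  have "(\<Sum>z\<in>I. add_char (b \<bullet> gvalue z) * add_char (a \<bullet> gpoint z)) = (\<Sum>(x, s)\<in>I. add_char (s * lin b a x))"
    using assms by (intro sum.cong) (auto simp: gvalue_def gpoint_def f_closed lin_def ring_distribs add_char_add)
  also have "\<dots> = (\<Sum>x\<in>V. of_nat (card S) * of_real (unit_kernel (lin b a x)))"
    by (simp add: sum_add_char_lin flip: sum.cartesian_product)
  also have "\<dots> = of_nat (card S) * of_real (\<Sum>x\<in>V. unit_kernel (lin b a x))"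
    by (simp flip: sum_distrib_left)
  finally show ?thesis
    by (simp add: sum_unit_kernel_lin card_cartesian_product)
qed

text \<open>Fourier inversion of the squared coefficients in the variable \<open>a\<close> alone; by
  \<open>dens_inversion\<close> it is the transform of \<open>dens s\<close> on
  \<open>W\<close>.\<close>

definition slice :: "'p mod_ring vec \<Rightarrow> 'p mod_ring vec \<Rightarrow> complex" where
  "slice b s = (\<Sum>a\<in>V. of_real ((fcoeff b a)\<^sup>2) * cnj (add_char (a \<bullet> s)))"

text \<open>Squaring the characteristic function corresponds to adding two independent scaled graph
  points; orthogonality in both variables recovers the density of the sum.\<close>

lemma dens_fourier:
  assumes s: "s \<in> V" and w: "w \<in> W"
  shows "of_nat (card W) * of_real (dens s w) = (\<Sum>b\<in>W. slice b s * cnj (add_char (b \<bullet> w)))"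
proof -
  let ?c = "of_nat ((card I)\<^sup>2) :: complex"
  let ?t = "\<lambda>b a z z'. (add_char (b \<bullet> (gvalue z + gvalue z')) * cnj (add_char (b \<bullet> w))) *
      (add_char (a \<bullet> (gpoint z + gpoint z')) * cnj (add_char (a \<bullet> s)))"
  have sq: "?c * of_real ((fcoeff b a)\<^sup>2) * cnj (add_char (a \<bullet> s)) * cnj (add_char (b \<bullet> w))
      = (\<Sum>z\<in>I. \<Sum>z'\<in>I. ?t b a z z')" if "b \<in> W" "a \<in> V" for a b
  proof -
    have "?c * of_real ((fcoeff b a)\<^sup>2) = (of_nat (card I) * of_real (fcoeff b a))\<^sup>2"
      by (simp add: power_mult_distrib)
    also have "\<dots> = (\<Sum>z\<in>I. \<Sum>z'\<in>I. add_char (b \<bullet> (gvalue z + gvalue z')) * add_char (a \<bullet> (gpoint z + gpoint z')))"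
      unfolding fcoeff_fourier[OF that] power2_eq_square sum_product
    proof (intro sum.cong refl)
      fix z z' assume "z \<in> I" "z' \<in> I"
      then have "b \<bullet> (gvalue z + gvalue z') = b \<bullet> gvalue z + b \<bullet> gvalue z'" "a \<bullet> (gpoint z + gpoint z') = a \<bullet> gpoint z + a \<bullet> gpoint z'"
        using that by (auto intro!: scalar_prod_add_distrib gpoint_gvalue_closed simp del: mem_Sigma_iff)
      then show "add_char (b \<bullet> gvalue z) * add_char (a \<bullet> gpoint z) * (add_char (b \<bullet> gvalue z') * add_char (a \<bullet> gpoint z')) =
         add_char (b \<bullet> (gvalue z + gvalue z')) * add_char (a \<bullet> (gpoint z + gpoint z'))"
        by (simp add: add_char_add)
    qed
    finally show ?thesis
      by (simp only: sum_distrib_right sum_distrib_left mult_ac)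
  qed
  have "?c * (\<Sum>b\<in>W. slice b s * cnj (add_char (b \<bullet> w))) =
    (\<Sum>b\<in>W. \<Sum>a\<in>V. ?c * of_real ((fcoeff b a)\<^sup>2) * cnj (add_char (a \<bullet> s)) * cnj (add_char (b \<bullet> w)))"
    by (simp only: slice_def sum_distrib_left sum_distrib_right mult.assoc)
  also have "\<dots> = (\<Sum>b\<in>W. \<Sum>a\<in>V. \<Sum>z\<in>I. \<Sum>z'\<in>I. ?t b a z z')"
    by (intro sum.cong refl sq)
  also have "\<dots> = (\<Sum>b\<in>W. \<Sum>z\<in>I. \<Sum>z'\<in>I. \<Sum>a\<in>V. ?t b a z z')"
    by (simp only: sum.swap[of _ _ V])
  also have "\<dots> = (\<Sum>z\<in>I. \<Sum>z'\<in>I. \<Sum>b\<in>W. \<Sum>a\<in>V. ?t b a z z')"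
    by (simp only: sum.swap[of _ _ W])
  also have "\<dots> = (\<Sum>z\<in>I. \<Sum>z'\<in>I. (\<Sum>b\<in>W. add_char (b \<bullet> (gvalue z + gvalue z')) * cnj (add_char (b \<bullet> w))) *
      (\<Sum>a\<in>V. add_char (a \<bullet> (gpoint z + gpoint z')) * cnj (add_char (a \<bullet> s))))"
    by (simp only: sum_product)
  also have "\<dots> = (\<Sum>z\<in>I. \<Sum>z'\<in>I. of_nat (card W * card V) * (of_bool (gvalue z + gvalue z' = w) * of_bool (gpoint z + gpoint z' = s)))"
    using s w by (intro sum.cong refl) (simp add: sum_add_char_scalar_prod_diff del: mem_Sigma_iff)
  also have "\<dots> = of_real (real (card W) * (real (card V) * (\<Sum>z\<in>I. \<Sum>z'\<in>I. of_bool (gvalue z + gvalue z' = w) * of_bool (gpoint z + gpoint z' = s))))"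
    by (simp only: sum_distrib_left of_real_sum of_real_mult of_real_of_nat_eq of_nat_mult mult.assoc of_real_of_bool)
  also have "real (card V) * (\<Sum>z\<in>I. \<Sum>z'\<in>I. of_bool (gvalue z + gvalue z' = w) * of_bool (gpoint z + gpoint z' = s)) = (card I)\<^sup>2 * dens s w"
    by (simp add: dens_def card_cartesian_product)
  finally have eq: "?c * (\<Sum>b\<in>W. slice b s * cnj (add_char (b \<bullet> w))) = ?c * (of_nat (card W) * of_real (dens s w))"
    by (simp only: of_real_mult of_real_of_nat_eq mult_ac)
  have nz: "?c \<noteq> 0"
    by (simp only: of_nat_eq_0_iff power_eq_0_iff card_cartesian_product mult_eq_0_iff card_nonzero simp_thms)
  show ?thesis
    using eq unfolding mult_left_cancel[OF nz] by (rule sym)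
qed

lemma dens_inversion:
  assumes s: "s \<in> V" and b: "b \<in> W"
  shows "(\<Sum>w\<in>W. of_real (dens s w) * add_char (b \<bullet> w)) = slice b s"
proof -
  have "of_nat (card W) * (\<Sum>w\<in>W. of_real (dens s w) * add_char (b \<bullet> w)) =
    (\<Sum>w\<in>W. (\<Sum>b'\<in>W. slice b' s * cnj (add_char (b' \<bullet> w))) * add_char (b \<bullet> w))"
    by (simp add: sum_distrib_left s mult.assoc flip: dens_fourier)
  also have "\<dots> = (\<Sum>w\<in>W. \<Sum>b'\<in>W. slice b' s * (add_char (w \<bullet> b) * cnj (add_char (w \<bullet> b'))))"
    using b by (intro sum.cong refl) (simp add: sum_distrib_right sum_distrib_left mult_ac comm_scalar_prod[of _ r])
  also have "\<dots> = (\<Sum>b'\<in>W. slice b' s * (\<Sum>w\<in>W. add_char (w \<bullet> b) * cnj (add_char (w \<bullet> b'))))"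
    by (subst sum.swap) (simp add: sum_distrib_left)
  also have "\<dots> = (\<Sum>b'\<in>W. slice b' s * (of_nat (card W) * of_bool (b = b')))"
    using b by (simp add: sum_add_char_scalar_prod_diff)
  also have "\<dots> = of_nat (card W) * slice b s"
    using b by (subst sum.mono_neutral_right[of _ "{b}"]) auto
  finally show ?thesis by simp
qed

text \<open>For \<open>b = 0\<close> the map \<open>f\<close> disappears and orthogonality on
  \<open>V\<close> remains. This normalizes \<open>dens s\<close> to total mass 1.\<close>

lemma fcoeff_0_left:
  assumes "a \<in> V"
  shows "fcoeff (0\<^sub>v r) a = of_bool (a = 0\<^sub>v n)"
proof -
  have lin0: "lin (0\<^sub>v r) a x = a \<bullet> x" if "x \<in> V" for x
    using that by (simp add: lin_def f_closed)
  have "of_real (card S * (card V * fcoeff (0\<^sub>v r) a)) = (\<Sum>x\<in>V. \<Sum>s\<in>S. add_char (s * (a \<bullet> x)))"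
    by (simp add: sum_add_char_lin lin0 flip: sum_unit_kernel_lin sum_distrib_left)
  also have "\<dots> = (\<Sum>s\<in>S. \<Sum>x\<in>V. add_char (x \<bullet> (s \<cdot>\<^sub>v a)))"
    using assms by (subst sum.swap) (simp add: comm_scalar_prod[of a n])
  also have "\<dots> = (\<Sum>s\<in>S. if a = 0\<^sub>v n then of_nat (card V) else 0)"
  proof (intro sum.cong refl)
    fix s :: "'p mod_ring" assume "s \<in> S"
    then have "s \<cdot>\<^sub>v a = 0\<^sub>v n \<longleftrightarrow> a = 0\<^sub>v n"
      using assms by (auto simp: vec_eq_iff)
    then show "(\<Sum>x\<in>V. add_char (x \<bullet> (s \<cdot>\<^sub>v a))) = (if a = 0\<^sub>v n then of_nat (card V) else 0)"
      using assms by (subst sum_add_char_scalar_prod) simp_all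
  qed
  also have "\<dots> = of_real (card S * (card V * of_bool (a = 0\<^sub>v n)))"
    by simp
  finally show ?thesis
    by (simp only: of_real_eq_iff) simp
qed

lemma sum_dens:
  assumes s: "s \<in> V"
  shows "(\<Sum>w\<in>W. dens s w) = 1"
proof -
  have "of_real (\<Sum>w\<in>W. dens s w) = (\<Sum>w\<in>W. of_real (dens s w) * add_char (0\<^sub>v r \<bullet> w))"
    by simp
  also have "\<dots> = slice (0\<^sub>v r) s"
    using s by (rule dens_inversion) simp
  also have "\<dots> = (\<Sum>a\<in>V. of_bool (a = 0\<^sub>v n) * cnj (add_char (a \<bullet> s)))"
    unfolding slice_def by (intro sum.cong refl) (simp add: fcoeff_0_left)
  also have "\<dots> = 1"
    using s by (subst sum.mono_neutral_right[of _ "{0\<^sub>v n}"]) auto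
  finally show ?thesis by (simp only: of_real_eq_1_iff)
qed

text \<open>The sum is \<open>slice b\<close> at the zero vector, a Fourier coefficient of a
  probability density.\<close>

lemma sum_fcoeff_sq_le_1:
  assumes "b \<in> W"
  shows "(\<Sum>a\<in>V. (fcoeff b a)\<^sup>2) \<le> 1"
proof -
  have "of_real (\<Sum>a\<in>V. (fcoeff b a)\<^sup>2) = slice b (0\<^sub>v n)"
    by (simp add: slice_def)
  also have "\<dots> = (\<Sum>w\<in>W. of_real (dens (0\<^sub>v n) w) * add_char (b \<bullet> w))"
    using assms by (simp add: dens_inversion)
  also have "norm \<dots> \<le> (\<Sum>w\<in>W. dens (0\<^sub>v n) w)"
    by (rule order.trans[OF norm_sum]) (simp add: norm_mult dens_nonneg)
  also have "\<dots> = 1" by (simp add: sum_dens)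
  finally show ?thesis by (simp only: norm_of_real abs_of_nonneg[OF sum_nonneg[OF zero_le_power2]])
qed

text \<open>Parseval's identity for \<open>dens s\<close> on \<open>W\<close>.\<close>

lemma sum_norm_slice_sq:
  assumes s: "s \<in> V"
  shows "(\<Sum>b\<in>W. (norm (slice b s))\<^sup>2) = card W * (\<Sum>w\<in>W. (dens s w)\<^sup>2)"
proof -
  have "of_real (\<Sum>b\<in>W. (norm (slice b s))\<^sup>2) = (\<Sum>b\<in>W. slice b s * cnj (slice b s))"
    by (simp add: complex_norm_square del: of_real_power)
  also have "\<dots> = (\<Sum>b\<in>W. \<Sum>w\<in>W. of_real (dens s w) * (slice b s * cnj (add_char (b \<bullet> w))))"
    using s by (intro sum.cong refl) (subst (2) dens_inversion[symmetric], simp_all add: sum_distrib_left mult_ac)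
  also have "\<dots> = (\<Sum>w\<in>W. of_real (dens s w) * (\<Sum>b\<in>W. slice b s * cnj (add_char (b \<bullet> w))))"
    by (subst sum.swap) (simp add: sum_distrib_left)
  also have "\<dots> = (\<Sum>w\<in>W. of_real (dens s w) * (of_nat (card W) * of_real (dens s w)))"
    using s by (simp add: dens_fourier)
  also have "\<dots> = of_real (card W * (\<Sum>w\<in>W. (dens s w)\<^sup>2))"
    by (simp add: power2_eq_square sum_distrib_left mult_ac)
  finally show ?thesis by (simp only: of_real_eq_iff)
qed

lemma dens_eq_Re:
  assumes "s \<in> V" "w \<in> W"
  shows "card W * dens s w = (\<Sum>b\<in>W. \<Sum>a\<in>V. (fcoeff b a)\<^sup>2 * Re (add_char (b \<bullet> w + a \<bullet> s)))"
proof -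
  have "card W * dens s w = Re (of_nat (card W) * of_real (dens s w))"
    by simp
  also have "\<dots> = Re (\<Sum>b\<in>W. \<Sum>a\<in>V. of_real ((fcoeff b a)\<^sup>2) * cnj (add_char (b \<bullet> w + a \<bullet> s)))"
    unfolding dens_fourier[OF assms] slice_def
    by (simp only: sum_distrib_right sum_distrib_left add_char_add complex_cnj_mult mult_ac)
  also have "\<dots> = (\<Sum>b\<in>W. \<Sum>a\<in>V. (fcoeff b a)\<^sup>2 * Re (add_char (b \<bullet> w + a \<bullet> s)))"
    by (simp add: Re_sum del: of_real_power)
  finally show ?thesis .
qed

text \<open>Positive definiteness: average \<open>Re_mult_unit_ge\<close> with the nonnegative
  weights \<open>(fcoeff b a)\<^sup>2\<close>. Their total is at most \<open>card W\<close>, which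
  keeps the constant 3.\<close>

lemma dens_add:
  assumes s: "s \<in> V" "s' \<in> V" and w: "w \<in> W" "w' \<in> W"
  shows "dens (s + s') (w + w') \<ge> 2 * dens s w + 2 * dens s' w' - 3"
proof -
  let ?g = "\<lambda>b a w s. Re (add_char (b \<bullet> w + a \<bullet> s))"
  have "card W * (2 * dens s w + 2 * dens s' w') =
      2 * (card W * dens s w) + 2 * (card W * dens s' w')"
    by (simp add: algebra_simps)
  also have "\<dots> = (\<Sum>b\<in>W. \<Sum>a\<in>V. (fcoeff b a)\<^sup>2 * (2 * ?g b a w s + 2 * ?g b a w' s'))"
    unfolding dens_eq_Re[OF s(1) w(1)] dens_eq_Re[OF s(2) w(2)]
    by (simp add: sum_distrib_left ring_distribs sum.distrib mult.left_commute)
  also have "\<dots> \<le> (\<Sum>b\<in>W. \<Sum>a\<in>V. (fcoeff b a)\<^sup>2 * ?g b a (w + w') (s + s') + 3 * (fcoeff b a)\<^sup>2)"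
  proof (intro sum_mono)
    fix b a assume b: "b \<in> W" "a \<in> V"
    then have "b \<bullet> (w + w') + a \<bullet> (s + s') = (b \<bullet> w + a \<bullet> s) + (b \<bullet> w' + a \<bullet> s')"
      using s w by (simp add: scalar_prod_add_distrib)
    then have "2 * ?g b a w s + 2 * ?g b a w' s' \<le> ?g b a (w + w') (s + s') + 3"
      using Re_mult_unit_ge[of "add_char (b \<bullet> w + a \<bullet> s)" "add_char (b \<bullet> w' + a \<bullet> s')"]
      by (simp add: add_char_add[of "b \<bullet> w + a \<bullet> s" "b \<bullet> w' + a \<bullet> s'"])
    then have "(fcoeff b a)\<^sup>2 * (2 * ?g b a w s + 2 * ?g b a w' s') \<le> (fcoeff b a)\<^sup>2 * (?g b a (w + w') (s + s') + 3)"
      by (rule mult_left_mono) simp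
    then show "(fcoeff b a)\<^sup>2 * (2 * ?g b a w s + 2 * ?g b a w' s') \<le>
        (fcoeff b a)\<^sup>2 * ?g b a (w + w') (s + s') + 3 * (fcoeff b a)\<^sup>2"
      by (simp add: ring_distribs)
  qed
  also have "\<dots> = card W * dens (s + s') (w + w') + 3 * (\<Sum>b\<in>W. \<Sum>a\<in>V. (fcoeff b a)\<^sup>2)"
    using s w by (simp add: dens_eq_Re sum.distrib sum_distrib_left)
  also have "(\<Sum>b\<in>W. \<Sum>a\<in>V. (fcoeff b a)\<^sup>2) \<le> (\<Sum>b\<in>W. 1)"
    by (intro sum_mono sum_fcoeff_sq_le_1)
  finally have "card W * (2 * dens s w + 2 * dens s' w') \<le> card W * (dens (s + s') (w + w') + 3)"
    by (simp add: ring_distribs)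
  then show ?thesis by simp
qed

subsection \<open>Decoding a homomorphism\<close>

lemma sum_unit_kernel_scalar_prod:
  assumes "u \<in> W"
  shows "(\<Sum>b\<in>W. unit_kernel (b \<bullet> u)) = card W * of_bool (u = 0\<^sub>v r)"
proof -
  have "of_real (card S * (\<Sum>b\<in>W. unit_kernel (b \<bullet> u))) = (\<Sum>b\<in>W. \<Sum>s\<in>S. add_char (s * (b \<bullet> u)))"
    by (simp add: sum_add_char_lin flip: sum_distrib_left)
  also have "\<dots> = (\<Sum>s\<in>S. \<Sum>b\<in>W. add_char (b \<bullet> (s \<cdot>\<^sub>v u)))"
    using assms by (subst sum.swap) simp
  also have "\<dots> = (\<Sum>s\<in>S. of_nat (card W) * of_bool (u = 0\<^sub>v r))"
  proof (intro sum.cong refl)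
    fix s :: "'p mod_ring" assume "s \<in> S"
    then have "s \<cdot>\<^sub>v u = 0\<^sub>v r \<longleftrightarrow> u = 0\<^sub>v r"
      using assms by (auto simp: vec_eq_iff)
    then show "(\<Sum>b\<in>W. add_char (b \<bullet> (s \<cdot>\<^sub>v u))) = of_nat (card W) * of_bool (u = 0\<^sub>v r)"
      using assms by (subst sum_add_char_scalar_prod) simp_all
  qed
  also have "\<dots> = of_real (card S * (card W * of_bool (u = 0\<^sub>v r)))"
    by simp
  finally show ?thesis
    by (simp only: of_real_eq_iff) simp
qed

text \<open>For each \<open>b\<close>, apply \<open>norm_weighted_sum_ge\<close> to the weights
  \<open>(fcoeff b a)\<^sup>2\<close>, then Parseval. Since \<open>m + 1 \<ge> 4\<close> and
  coefficients are at most 1 in modulus, fourth powers dominate.\<close>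

lemma sum_dens_sq_ge:
  assumes s: "s \<in> V" and m: "m \<ge> 3"
  shows "(\<Sum>w\<in>W. (dens s w)\<^sup>2) \<ge> 4 * acceptance m - 3"
proof -
  have "card W * (4 * acceptance m - 3) = (\<Sum>b\<in>W. 4 * (\<Sum>a\<in>V. fcoeff b a ^ (m + 1)) - 3)"
    by (simp add: acceptance_def sum_subtractf ring_distribs flip: sum_distrib_left)
  also have "\<dots> \<le> (\<Sum>b\<in>W. (norm (slice b s))\<^sup>2)"
  proof (intro sum_mono)
    fix b assume b: "b \<in> W"
    have "fcoeff b a ^ (m + 1) \<le> ((fcoeff b a)\<^sup>2)\<^sup>2" for a
    proof -
      have "fcoeff b a ^ (m + 1) \<le> \<bar>fcoeff b a\<bar> ^ (m + 1)"
        by (metis abs_ge_self power_abs)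
      also have "\<dots> \<le> \<bar>fcoeff b a\<bar> ^ 4"
        using m by (intro power_decreasing abs_fcoeff_le_1) auto
      finally show ?thesis by (simp add: power_even_abs)
    qed
    then have "(\<Sum>a\<in>V. fcoeff b a ^ (m + 1)) \<le> (\<Sum>a\<in>V. ((fcoeff b a)\<^sup>2)\<^sup>2)"
      by (intro sum_mono)
    moreover have "(norm (slice b s))\<^sup>2 \<ge> 4 * (\<Sum>a\<in>V. ((fcoeff b a)\<^sup>2)\<^sup>2) - 3"
      unfolding slice_def using sum_fcoeff_sq_le_1[OF b]
      by (intro norm_weighted_sum_ge) auto
    ultimately show "4 * (\<Sum>a\<in>V. fcoeff b a ^ (m + 1)) - 3 \<le> (norm (slice b s))\<^sup>2"
      by linarith
  qed
  also have "\<dots> = card W * (\<Sum>w\<in>W. (dens s w)\<^sup>2)"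
    by (rule sum_norm_slice_sq[OF s])
  finally show ?thesis by simp
qed

lemma exists_dense_additive:
  assumes m: "m \<ge> 3" and acc: "acceptance m > 15 / 16"
  obtains h where "\<And>s. s \<in> V \<Longrightarrow> h s \<in> W" "\<And>s. s \<in> V \<Longrightarrow> dens s (h s) > 4 / 5"
    "\<And>s t. s \<in> V \<Longrightarrow> t \<in> V \<Longrightarrow> h (s + t) = h s + h t"
proof -
  have "\<exists>w\<in>W. dens s w > 4 / 5" if "s \<in> V" for s
    \<comment> \<open>The threshold is chosen so that
      \<open>4 * (15 / 16) - 3 = 3 / 4\<close>.\<close>
    using sum_dens_sq_ge[OF that m] acc by (intro exists_large_weight) (auto simp: dens_nonneg sum_dens that)
  then obtain h where h: "h s \<in> W" "dens s (h s) > 4 / 5" if "s \<in> V" for s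
    by metis
  have "h (s + t) = h s + h t" if "s \<in> V" "t \<in> V" for s t
  proof (rule ccontr)
    \<comment> \<open>The first value carries mass above 4/5 and, by \<open>dens_add\<close>, the
      second above \<open>4 * (4 / 5) - 3 = 1 / 5\<close>; together they would exceed the total mass
      1.\<close>
    assume "h (s + t) \<noteq> h s + h t"
    then have "dens (s + t) (h (s + t)) + dens (s + t) (h s + h t) = (\<Sum>w\<in>{h (s + t), h s + h t}. dens (s + t) w)"
      by simp
    also have "\<dots> \<le> (\<Sum>w\<in>W. dens (s + t) w)"
      using that h(1) by (intro sum_mono2) (auto simp: dens_nonneg)
    also have "\<dots> = 1"
      using that by (simp add: sum_dens)
    finally show False
      using h(2)[of s] h(2)[of t] h(2)[of "s + t"] dens_add[of s t "h s" "h t"] h(1) that by force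
  qed
  with h that show thesis by blast
qed

text \<open>
  The map \<open>s \<mapsto> add_char (b \<bullet> h s + a \<bullet> s)\<close> is a character, so averaging \<open>slice b s\<close> against the
  character of \<open>b \<bullet> h s\<close> picks out a single coefficient. This yields the dual vector without
  scalar linearity of \<open>h\<close>.
\<close>

lemma exists_aligned_coeff:
  assumes h: "\<And>s. s \<in> V \<Longrightarrow> h s \<in> W" "\<And>s. s \<in> V \<Longrightarrow> dens s (h s) > 4 / 5"
    "\<And>s t. s \<in> V \<Longrightarrow> t \<in> V \<Longrightarrow> h (s + t) = h s + h t"
    and b: "b \<in> W"
  shows "\<exists>a\<in>V. (\<forall>s\<in>V. b \<bullet> h s + a \<bullet> s = 0) \<and> (fcoeff b a)\<^sup>2 \<ge> 3 / 5"
proof -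
  define ann where "ann a \<longleftrightarrow> (\<forall>s\<in>V. b \<bullet> h s + a \<bullet> s = 0)" for a
  have char_sum: "(\<Sum>s\<in>V. cnj (add_char (b \<bullet> h s + a \<bullet> s))) = of_nat (card V) * of_bool (ann a)" if "a \<in> V" for a
  proof -
    have "(\<Sum>s\<in>V. add_char (b \<bullet> h s + a \<bullet> s)) = of_nat (card V) * of_bool (ann a)"
      using that b h(1,3)
      by (subst sum_character_carrier_vec)
        (auto simp: ann_def add_char_eq_1_iff scalar_prod_add_distrib simp flip: add_char_add intro!: arg_cong[of _ _ add_char])
    then show ?thesis by (simp flip: cnj_sum)
  qed
  \<comment> \<open>After the rotation the mass at \<open>h s\<close> counts fully, and the
    remaining mass, below 1/5, at worst with sign -1.\<close>
  have ge: "Re (slice b s * cnj (add_char (b \<bullet> h s))) \<ge> 3 / 5" if s: "s \<in> V" for s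
  proof -
    have "2 * dens s (h s) - 1 = dens s (h s) - (\<Sum>w\<in>W - {h s}. dens s w)"
      using s h(1) sum_dens[OF s] by (simp add: sum_diff1)
    also have "\<dots> \<le> dens s (h s) + (\<Sum>w\<in>W - {h s}. dens s w * Re (add_char (b \<bullet> w) * cnj (add_char (b \<bullet> h s))))"
    proof -
      have "- dens s w \<le> dens s w * Re (add_char (b \<bullet> w) * cnj (add_char (b \<bullet> h s)))" for w
      proof -
        have "\<bar>Re (add_char (b \<bullet> w) * cnj (add_char (b \<bullet> h s)))\<bar> \<le> 1"
          by (rule order.trans[OF abs_Re_le_cmod]) (simp add: norm_mult)
        then have "dens s w * (-1) \<le> dens s w * Re (add_char (b \<bullet> w) * cnj (add_char (b \<bullet> h s)))"
          by (intro mult_left_mono dens_nonneg) linarith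
        then show ?thesis by simp
      qed
      then show ?thesis
        by (simp only: sum_negf[symmetric] diff_conv_add_uminus) (intro add_left_mono sum_mono)
    qed
    also have "\<dots> = (\<Sum>w\<in>W. dens s w * Re (add_char (b \<bullet> w) * cnj (add_char (b \<bullet> h s))))"
      using h(1)[OF s] by (simp add: sum.remove[of W "h s"] flip: add_char_diff)
    also have "\<dots> = Re (\<Sum>w\<in>W. of_real (dens s w) * add_char (b \<bullet> w) * cnj (add_char (b \<bullet> h s)))"
      by (simp only: Re_sum mult.assoc) simp
    also have "\<dots> = Re (slice b s * cnj (add_char (b \<bullet> h s)))"
      using s b by (simp only: sum_distrib_right[symmetric] dens_inversion)
    finally show ?thesis using h(2)[OF s] by linarith
  qed
  have "card V * (3 / 5) \<le> (\<Sum>s\<in>V. Re (slice b s * cnj (add_char (b \<bullet> h s))))"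
    using sum_mono[OF ge, of V "\<lambda>x. x"] by simp
  also have "\<dots> = Re (\<Sum>s\<in>V. \<Sum>a\<in>V. of_real ((fcoeff b a)\<^sup>2) * cnj (add_char (b \<bullet> h s + a \<bullet> s)))"
    by (simp only: Re_sum[symmetric] slice_def sum_distrib_right sum_distrib_left add_char_add complex_cnj_mult mult_ac)
  also have "(\<Sum>s\<in>V. \<Sum>a\<in>V. of_real ((fcoeff b a)\<^sup>2) * cnj (add_char (b \<bullet> h s + a \<bullet> s))) =
      (\<Sum>a\<in>V. of_real ((fcoeff b a)\<^sup>2) * (\<Sum>s\<in>V. cnj (add_char (b \<bullet> h s + a \<bullet> s))))"
    by (subst sum.swap) (simp only: sum_distrib_left)
  also have "\<dots> = of_real (card V * (\<Sum>a\<in>V. (fcoeff b a)\<^sup>2 * of_bool (ann a)))"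
    by (simp add: char_sum sum_distrib_left mult_ac)
  finally have mass: "3 / 5 \<le> (\<Sum>a\<in>V. (fcoeff b a)\<^sup>2 * of_bool (ann a))"
    by simp
  have "\<exists>a\<in>V. ann a"
  proof (rule ccontr)
    assume "\<not> (\<exists>a\<in>V. ann a)"
    then have "(\<Sum>a\<in>V. (fcoeff b a)\<^sup>2 * of_bool (ann a)) = 0"
      by (intro sum.neutral) auto
    with mass show False by simp
  qed
  then obtain a where a: "a \<in> V" "ann a"
    by blast
  \<comment> \<open>All annihilating vectors induce the same functional on \<open>V\<close>, so the
    whole mass 3/5 sits on one coefficient.\<close>
  have uniq: "a' = a" if "a' \<in> V" "ann a'" for a'
  proof -
    have "s \<bullet> (a' - a) = 0" if s: "s \<in> V" for s
    proof -
      have "a' \<bullet> s = a \<bullet> s"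
        using a \<open>ann a'\<close> s by (metis ann_def add_left_imp_eq)
      then show ?thesis
        using s a \<open>a' \<in> V\<close> by (simp add: scalar_prod_minus_distrib comm_scalar_prod[of s n])
    qed
    then have "a' - a = 0\<^sub>v n"
      using a that by (intro scalar_prod_nondegenerate) auto
    then show ?thesis
      using a that by (auto simp: vec_eq_iff)
  qed
  have "\<not> ann a'" if "a' \<in> V - {a}" for a'
    using uniq that by blast
  then have "(\<Sum>a\<in>V. (fcoeff b a)\<^sup>2 * of_bool (ann a)) = (fcoeff b a)\<^sup>2"
    using a by (subst sum.mono_neutral_right[of _ "{a}"]) auto
  with mass a show ?thesis unfolding ann_def by auto
qed


section \<open>Rejection probability in terms of the distance to the decoded homomorphism\<close>

lemma rejection_ge:
  assumes far: "far_from_hom \<epsilon> n r f" and m: "even m" "m \<ge> 4" and \<epsilon>: "\<epsilon> > 0"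
  shows "1 - acceptance m \<ge> min ((real m - 3) * \<epsilon> / 3) (1 / 16)"
proof (cases "acceptance m > 15 / 16")
  case True
  \<comment> \<open>Of the \<open>m + 1\<close> factors, two are spent on the sum of squares; the
    remaining exponent is odd because \<open>m\<close> is even.\<close>
  define N where "N = m - 1"
  have N: "odd N" "N \<ge> 3" "m + 1 = N + 2" and N_real: "real m - 3 = real N - 2"
    using m by (auto simp: N_def of_nat_diff)
  have m3: "m \<ge> 3" using m by simp
  obtain h where h: "\<And>s. s \<in> V \<Longrightarrow> h s \<in> W" "\<And>s. s \<in> V \<Longrightarrow> dens s (h s) > 4 / 5"
    "\<And>s t. s \<in> V \<Longrightarrow> t \<in> V \<Longrightarrow> h (s + t) = h s + h t"
    using exists_dense_additive[OF m3 True] by blast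
  define \<eta> where "\<eta> = real (card {x \<in> V. f x \<noteq> h x}) / card V"
  have "h \<in> hom (monoid_vec TYPE('p mod_ring) n) (monoid_vec TYPE('p mod_ring) r)"
    using h by (auto simp: hom_def monoid_vec_simps)
  then have "measure_pmf.prob (pmf_of_set V) {x. f x \<noteq> h x} > \<epsilon>"
    using far by (auto simp: far_from_hom_def)
  moreover have "V \<inter> {x. f x \<noteq> h x} = {x \<in> V. f x \<noteq> h x}" by auto
  ultimately have \<eta>: "\<eta> > \<epsilon>"
    unfolding \<eta>_def by (simp add: measure_pmf_of_set finite_carrier_vec_mod_ring)
  have "\<forall>b\<in>W. \<exists>a. a \<in> V \<and> (\<forall>s\<in>V. b \<bullet> h s + a \<bullet> s = 0) \<and> (fcoeff b a)\<^sup>2 \<ge> 3 / 5"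
    using exists_aligned_coeff[OF h] by blast
  then obtain \<alpha> where "\<forall>b\<in>W. \<alpha> b \<in> V \<and> (\<forall>s\<in>V. b \<bullet> h s + \<alpha> b \<bullet> s = 0) \<and> (fcoeff b (\<alpha> b))\<^sup>2 \<ge> 3 / 5"
    by (rule bchoice[THEN exE])
  then have \<alpha>: "\<alpha> b \<in> V" "\<And>s. s \<in> V \<Longrightarrow> b \<bullet> h s + \<alpha> b \<bullet> s = 0" "(fcoeff b (\<alpha> b))\<^sup>2 \<ge> 3 / 5"
    if "b \<in> W" for b
    using that by blast+
  define t where "t b = 1 - fcoeff b (\<alpha> b)" for b
  have lin_eq: "lin b (\<alpha> b) x = b \<bullet> (f x - h x)" if "b \<in> W" "x \<in> V" for b x
  proof -
    have "lin b (\<alpha> b) x = b \<bullet> f x - b \<bullet> h x"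
      unfolding lin_def using \<alpha>(2)[OF that] by (simp add: add_eq_0_iff2)
    then show ?thesis
      using that h(1) f_closed by (simp add: scalar_prod_minus_distrib)
  qed
  \<comment> \<open>Where \<open>f\<close> and \<open>h\<close> agree,
    \<open>lin b (\<alpha> b)\<close> vanishes and nothing is lost; elsewhere the loss is at most
    2.\<close>
  have t_le: "t b \<le> 2 * \<eta>" if "b \<in> W" for b
  proof -
    have "card V * t b = (\<Sum>x\<in>V. 1 - unit_kernel (lin b (\<alpha> b) x))"
      by (simp add: t_def sum_subtractf sum_unit_kernel_lin ring_distribs)
    also have "\<dots> \<le> (\<Sum>x\<in>V. 2 * of_bool (f x \<noteq> h x))"
    proof (intro sum_mono)
      fix x assume x: "x \<in> V"
      have "lin b (\<alpha> b) x = 0" if "f x = h x"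
        using lin_eq[OF \<open>b \<in> W\<close> x] that \<open>b \<in> W\<close> h(1)[OF x] by simp
      then show "1 - unit_kernel (lin b (\<alpha> b) x) \<le> 2 * of_bool (f x \<noteq> h x)"
        using unit_kernel_bounds(2)[of "lin b (\<alpha> b) x"] by (cases "lin b (\<alpha> b) x = 0") auto
    qed
    also have "\<dots> = 2 * real (card {x \<in> V. f x \<noteq> h x})"
      by (simp add: Int_def flip: sum_distrib_left)
    finally show ?thesis by (simp add: \<eta>_def field_simps)
  qed
  have t_bounds: "0 \<le> t b" "t b \<le> 2" for b
    using abs_fcoeff_le_1[of b "\<alpha> b"] by (auto simp: t_def)
  \<comment> \<open>Averaged over \<open>b\<close>, the kernel of
    \<open>b \<bullet> (f x - h x)\<close> is the indicator of \<open>f x = h x\<close>.\<close>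
  have sum_t: "(\<Sum>b\<in>W. t b) = card W * \<eta>"
  proof -
    have "card V * (\<Sum>b\<in>W. fcoeff b (\<alpha> b)) = (\<Sum>b\<in>W. \<Sum>x\<in>V. unit_kernel (b \<bullet> (f x - h x)))"
      by (simp only: sum_distrib_left sum_unit_kernel_lin[symmetric] lin_eq cong: sum.cong)
    also have "\<dots> = (\<Sum>x\<in>V. real (card W) * of_bool (f x - h x = 0\<^sub>v r))"
      using f_closed h(1) by (subst sum.swap) (simp add: sum_unit_kernel_scalar_prod)
    also have "\<dots> = (\<Sum>x\<in>V. real (card W) * (1 - of_bool (f x \<noteq> h x)))"
    proof (intro sum.cong refl)
      fix x assume x: "x \<in> V"
      have "f x - h x = 0\<^sub>v r \<longleftrightarrow> f x = h x"
        using f_closed[OF x] h(1)[OF x] by (auto simp: vec_eq_iff)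
      then show "real (card W) * of_bool (f x - h x = 0\<^sub>v r) = real (card W) * (1 - of_bool (f x \<noteq> h x))"
        by simp
    qed
    also have "\<dots> = real (card W) * (\<Sum>x\<in>V. 1 - of_bool (f x \<noteq> h x))"
      by (simp only: sum_distrib_left)
    also have "(\<Sum>x\<in>V. 1 - of_bool (f x \<noteq> h x)) = real (card V) * (1 - \<eta>)"
      by (simp add: sum_subtractf Int_def \<eta>_def field_simps)
    finally have "(\<Sum>b\<in>W. fcoeff b (\<alpha> b)) = card W * (1 - \<eta>)"
      by simp
    then show ?thesis by (simp add: t_def sum_subtractf ring_distribs)
  qed
  have slice_le:
    "fcoeff b (\<alpha> b) \<ge> 0 \<Longrightarrow> (\<Sum>a\<in>V. fcoeff b a ^ (m + 1)) \<le> (1 - t b) ^ N"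
    "fcoeff b (\<alpha> b) < 0 \<Longrightarrow> (\<Sum>a\<in>V. fcoeff b a ^ (m + 1)) \<le> 2 / 5" if "b \<in> W" for b
    using sum_odd_power_le[OF finite_VW(1) \<alpha>(1)[OF that] sum_fcoeff_sq_le_1[OF that] \<alpha>(3)[OF that] N(1)]
    unfolding N(3) t_def by simp_all
  have acc: "card W * acceptance m = (\<Sum>b\<in>W. \<Sum>a\<in>V. fcoeff b a ^ (m + 1))"
    by (simp add: acceptance_def)
  \<comment> \<open>A crude bound covering both signs: \<open>t b \<le> 2\<close> makes the right
    side at least 1/2, above the 2/5 of the negative case. With acceptance above 15/16 it yields
    \<open>\<eta> < 1 / 4\<close>, so \<open>t b < 1 / 2\<close> and the negative case is
    excluded.\<close>
  have "(\<Sum>b\<in>W. \<Sum>a\<in>V. fcoeff b a ^ (m + 1)) \<le> (\<Sum>b\<in>W. 1 - t b / 4)"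
  proof (intro sum_mono)
    fix b assume b: "b \<in> W"
    show "(\<Sum>a\<in>V. fcoeff b a ^ (m + 1)) \<le> 1 - t b / 4"
    proof (cases "fcoeff b (\<alpha> b) \<ge> 0")
      case True
      have "(1 - t b) ^ N \<le> (1 - t b) ^ 1"
        using True t_bounds[of b] N(2) by (intro power_decreasing) (auto simp: t_def)
      then show ?thesis using slice_le(1)[OF b True] t_bounds[of b] by simp
    next
      case False
      then show ?thesis using slice_le(2)[OF b] t_bounds[of b] by simp
    qed
  qed
  also have "\<dots> = card W * (1 - \<eta> / 4)"
    by (simp add: sum_subtractf sum_t ring_distribs flip: sum_divide_distrib)
  finally have "card W * acceptance m \<le> card W * (1 - \<eta> / 4)"
    unfolding acc .
  then have \<eta>_small: "\<eta> < 1 / 4" using True by simp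
  \<comment> \<open>Replacing \<open>t b\<close> by its bound \<open>2 * \<eta>\<close> in the
    denominator of the Bernoulli estimate makes it linear in \<open>t b\<close>, so that it can be
    averaged over \<open>b\<close>.\<close>
  define c where "c = real N / (1 + 2 * real N * \<eta>)"
  have \<eta>0: "\<eta> > 0" using \<eta> \<epsilon> by simp
  have "(\<Sum>b\<in>W. \<Sum>a\<in>V. fcoeff b a ^ (m + 1)) \<le> (\<Sum>b\<in>W. 1 - c * t b)"
  proof (intro sum_mono)
    fix b assume b: "b \<in> W"
    have t1: "t b \<le> 1" using t_le[OF b] \<eta>_small by simp
    have pos: "1 + real N * t b > 0" using t_bounds[of b] by (simp add: add_pos_nonneg)
    have "(1 - t b) ^ N \<le> 1 / (1 + real N * t b)"
      using power_diff_one_le[OF t_bounds(1)[of b] t1, of N] pos by (simp add: field_simps)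
    also have "\<dots> = 1 - real N * t b / (1 + real N * t b)"
      using pos by (simp add: field_simps)
    also have "\<dots> \<le> 1 - real N * t b / (1 + 2 * real N * \<eta>)"
    proof -
      have "real N * t b \<le> real N * (2 * \<eta>)"
        using t_le[OF b] by (intro mult_left_mono) auto
      then show ?thesis
        using pos t_bounds(1)[of b] \<eta>0
        by (intro diff_left_mono divide_left_mono mult_pos_pos add_pos_nonneg mult_nonneg_nonneg) auto
    qed
    finally show "(\<Sum>a\<in>V. fcoeff b a ^ (m + 1)) \<le> 1 - c * t b"
      using slice_le(1)[OF b] t1 by (simp add: c_def t_def)
  qed
  also have "\<dots> = card W * (1 - c * \<eta>)"
    by (simp add: sum_subtractf sum_t ring_distribs flip: sum_distrib_left)
  finally have "card W * acceptance m \<le> card W * (1 - c * \<eta>)"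
    unfolding acc .
  then have rej: "1 - acceptance m \<ge> real N * \<eta> / (1 + 2 * real N * \<eta>)"
    by (simp add: c_def)
  have N\<eta>: "real N * \<eta> > 0" using N(2) \<eta>0 by simp
  show ?thesis
  \<comment> \<open>In the first case the denominator of \<open>rej\<close> is at most 3; in the
    second the fraction itself is at least 1/3, more than 1/16.\<close>
  proof (cases "real N * \<eta> \<le> 1")
    case True
    have "real N * \<eta> / 3 \<le> real N * \<eta> / (1 + 2 * real N * \<eta>)"
      using True N\<eta> by (intro divide_left_mono) auto
    moreover have "(real N - 2) * \<epsilon> \<le> real N * \<eta>"
      using \<eta> \<epsilon> N(2) by (intro mult_mono) auto
    ultimately show ?thesis using rej unfolding N_real by linarith
  next
    case False
    have "1 / 3 \<le> real N * \<eta> / (1 + 2 * real N * \<eta>)"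
      using False by (simp add: field_simps)
    then show ?thesis using rej by linarith
  qed
qed simp

end

theorem theorem6p6:
  fixes k n r :: nat and \<epsilon> :: real
    and f :: "'p::prime_card mod_ring vec \<Rightarrow> 'p mod_ring vec"
  assumes "0 < \<epsilon>" and "\<epsilon> < 1"
    and "f \<in> carrier_vec n \<rightarrow> carrier_vec r"
    and "far_from_hom \<epsilon> n r f"
  shows "measure_pmf.prob (random_coefficients_test (2 * k) n r f) {False}
           \<ge> min ((2 * real k - 3) * \<epsilon> / 3) (1 / 16)"
proof (cases "k \<ge> 2")
  case True
  interpret vec_map n r f
    using assms(3) by unfold_locales auto
  show ?thesis
    using rejection_ge[OF assms(4), of "2 * k"] True assms(1) by (simp add: prob_reject)
next
  case False
  \<comment> \<open>For \<open>k \<le> 1\<close> the factor \<open>2 * k - 3\<close> is negative, so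
    the claim is trivial.\<close>
  then have "(2 * real k - 3) * \<epsilon> / 3 \<le> 0"
    using assms(1) by (simp add: mult_nonpos_nonneg)
  then show ?thesis
    using measure_nonneg[of "random_coefficients_test (2 * k) n r f" "{False}"] by linarith
qed

end
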